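(* Let $m\ge1$ and, for $j=1,\ldots,m$, let $f_j:\mathbb{R}^d\to\mathbb{R}$ be convex and $T_j:\mathbb{R}^d\to\mathbb{R}^d$ firmly nonexpansive, with $\bigcap_{j=1}^m\mathrm{Fix}\,T_j\neq\emptyset$. Put $f=\sum_{j=1}^mf_j$ and assume that the set $\mathcal{S}_m^*$ of minimizers of $f$ over $\bigcap_{j=1}^m\mathrm{Fix}\,T_j$ is nonempty. Let $\tau_{\max}\in\mathbb{N}_0$, and for each $j$ let $\{\tau_n^j\}_{n=0}^\infty\subset\mathbb{N}_0$ satisfy $0\le\tau_n^j\le\tau_{\max}$ for all $n\in\mathbb{N}_0$. Let $\{\alpha_n\}_{n=0}^\infty\subset(0,\infty)$ satisfy $\lim_{n\to\infty}\alpha_n=0$ and $\sum_{n=0}^\infty\alpha_n=\infty$. Let $\{\mathbf{x}_n\}$ be generated by the Distributed Fixed-Point Delayed Subgradient Method: $\mathbf{x}_0=\mathbf{x}_{-1}=\cdots=\mathbf{x}_{-\tau_{\max}}\in\mathbb{R}^d$ and, for $n\in\mathbb{N}_0$, $$\mathbf{x}_{n,j}=T_j\mathbf{x}_n-\alpha_n\widetilde{\nabla}f_j(T_j\mathbf{x}_{n-\tau_n^j})\quad(j=1,\ldots,m),\qquad\mathbf{x}_{n+1}=\frac1m\sum_{j=1}^m\mathbf{x}_{n,j}.$$ Suppose that for each $j=1,\ldots,m$ there exists $M_j>0$ with $\|\mathbf{x}_{n,j}\|\le M_j$ for all $n\in\mathbb{N}_0$. Then there exists a subsequence of $\{\mathbf{x}_n\}_{n=0}^\infty$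 that converges to an optimal solution in $\mathcal{S}_m^*$. Furthermore, if $f$ is strictly convex, then the sequence $\{\mathbf{x}_n\}_{n=0}^\infty$ converges to the unique optimal solution of the problem of minimizing $f$ over $\bigcap_{j=1}^m\mathrm{Fix}\,T_j$.
   Context: $\mathbb{R}^d$ is Euclidean space with inner product $\langle\cdot,\cdot\rangle$ and induced norm $\|\cdot\|$; $\mathbb{N}_0$ is the set of nonnegative integers. An operator $T:\mathbb{R}^d\to\mathbb{R}^d$ is firmly nonexpansive if $\langle T\mathbf{x}-T\mathbf{y},\mathbf{x}-\mathbf{y}\rangle\ge\|T\mathbf{x}-T\mathbf{y}\|^2$ for all $\mathbf{x},\mathbf{y}\in\mathbb{R}^d$. $\mathrm{Fix}\,T=\{\mathbf{x}\in\mathbb{R}^d:T\mathbf{x}=\mathbf{x}\}$. For each $j$ and each $\mathbf{x}\in\mathbb{R}^d$, $\widetilde{\nabla}f_j(\mathbf{x})$ denotes a (chosen) subgradient of $f_j$ at $\mathbf{x}$, i.e. an element of $\partial f_j(\mathbf{x})=\{\mathbf{g}\in\mathbb{R}^d:\langle\mathbf{g},\mathbf{y}-\mathbf{x}\rangle\le f_j(\mathbf{y})-f_j(\mathbf{x})\ \forall\mathbf{y}\in\mathbb{R}^d\}$. *)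

theory Defs
  imports "HOL-Analysis.Analysis"
begin

definition firmly_nonexpansive :: "('a::real_inner \<Rightarrow> 'a) \<Rightarrow> bool" where
  "firmly_nonexpansive T \<longleftrightarrow> (\<forall>x y. (T x - T y) \<bullet> (x - y) \<ge> (norm (T x - T y))\<^sup>2)"

definition Fix :: "('a \<Rightarrow> 'a) \<Rightarrow> 'a set" where
  "Fix T = {x. T x = x}"

definition subdifferential :: "('a::real_inner \<Rightarrow> real) \<Rightarrow> 'a \<Rightarrow> 'a set" where
  "subdifferential f x = {g. \<forall>y. g \<bullet> (y - x) \<le> f y - f x}"

definition strictly_convex_on :: "'a::real_vector set \<Rightarrow> ('a \<Rightarrow> real) \<Rightarrow> bool" where
  "strictly_convex_on S f \<longleftrightarrow> convex S \<and>
     (\<forall>t x y. 0 < t \<longrightarrow> t < 1 \<longrightarrow> x \<in> S \<longrightarrow> y \<in> S \<longrightarrow> x \<noteq> y \<longrightarrow>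
        f ((1 - t) *\<^sub>R x + t *\<^sub>R y) < (1 - t) * f x + t * f y)"

definition minimizers :: "('a \<Rightarrow> real) \<Rightarrow> 'a set \<Rightarrow> 'a set" where
  "minimizers f C = {x. is_arg_min f (\<lambda>y. y \<in> C) x}"

text \<open>
  The Distributed Fixed-Point Delayed Subgradient Method.  The iterates \<open>x\<close> are indexed by
  integers, because the method starts from \<open>x (- \<tau>max), \<dots>, x (- 1), x 0\<close>;
  the values at indices below \<open>- \<tau>max\<close> are irrelevant.  The function \<open>g j\<close> is the
  chosen subgradient selection of \<open>f j\<close>, \<open>\<tau> j n\<close> is the delay of agent \<open>j\<close>
  at iteration \<open>n\<close>, and \<open>xa n j\<close> is the intermediate point of agent \<open>j\<close>.
\<close>
definition DFDSM ::
  "nat \<Rightarrow> (nat \<Rightarrow> 'a::euclidean_space \<Rightarrow> 'a) \<Rightarrow> (nat \<Rightarrow> 'a \<Rightarrow> 'a) \<Rightarrow> (nat \<Rightarrow> real) \<Rightarrow>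
    nat \<Rightarrow> (nat \<Rightarrow> nat \<Rightarrow> nat) \<Rightarrow> (int \<Rightarrow> 'a) \<Rightarrow> (nat \<Rightarrow> nat \<Rightarrow> 'a) \<Rightarrow> bool" where
  "DFDSM m T g \<alpha> \<tau>max \<tau> x xa \<longleftrightarrow>
     (\<forall>k \<in> {- int \<tau>max..0}. x k = x 0) \<and>
     (\<forall>n. \<forall>j \<in> {1..m}. xa n j = T j (x (int n)) - \<alpha> n *\<^sub>R g j (T j (x (int n - int (\<tau> j n))))) \<and>
     (\<forall>n. x (int n + 1) = (1 / real m) *\<^sub>R (\<Sum>j = 1..m. xa n j))"

end

theory Submission
  imports Defs
begin

text \<open>
  Let \<open>C\<close> be the common fixed point set, \<open>F\<close> the objective and \<open>S\<close> its set of minimizers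
  over \<open>C\<close>.  The whole sequence satisfies \<open>infdist (y n) S \<longlonglongrightarrow> 0\<close>, strict convexity or not
  (\<open>infdist_minimizers_tendsto_zero\<close>); since the iterates are bounded and \<open>S\<close> is closed, some
  subsequence then converges to a point of \<open>S\<close>, and when \<open>F\<close> is strictly convex \<open>S\<close> is a
  singleton, so that the full sequence converges.

  Expanding squared norms in one step gives, for every \<open>z \<in> C\<close>, a bound of
  \<open>(norm (y (Suc n) - z))\<^sup>2\<close> by \<open>(norm (y n - z))\<^sup>2\<close> minus the fixed point residual of \<open>y n\<close>, up to
  terms of order \<open>\<alpha> n\<close> (\<open>one_step\<close>).  This estimate is exploited twice, both times through the
  principle \<open>descent_tendsto_zero\<close>: a nonnegative sequence that grows by at most a multiple of
  \<open>\<alpha> n\<close> per step, and that drops by a fixed multiple of \<open>\<alpha> n\<close> per late step as long as it stays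
  away from zero, must tend to zero, because the steps \<open>\<alpha> n\<close> vanish but are not summable.

  The first use is with the squared distance to \<open>C\<close>.  Away from \<open>C\<close> the residual is bounded below
  by compactness, and so eventually dominates the terms of order \<open>\<alpha> n\<close>.  Hence the iterates approach
  \<open>C\<close>, the displacements \<open>T j (y n) - y n\<close> tend to zero, and so do the increments
  \<open>y (Suc n) - y n\<close>; this is what makes bounded delays harmless.

  With this knowledge the subgradient inequality refines the one-step estimate: the terms of order
  \<open>\<alpha> n\<close> become \<open>- 2 * \<alpha> n / m * (F (y n) - F z)\<close> plus \<open>\<alpha> n\<close> times a null sequence
  (\<open>objective_step\<close>).  The second use is with the squared distance to \<open>S\<close>.  A bounded iterate that
  is near \<open>C\<close> but away from \<open>S\<close> has, again by compactness, an objective value exceeding the minimum by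
  a fixed amount, and this supplies the drop.
\<close>

section \<open>Asymptotics of real and vector sequences\<close>

text \<open>
  If \<open>a\<close> stayed above \<open>\<epsilon> / 2\<close> from some index on, the drops \<open>c * \<alpha> n\<close> would add up to
  infinity, so \<open>a\<close> is below \<open>\<epsilon> / 2\<close> at arbitrarily late indices.  After such an index it never
  reaches \<open>\<epsilon>\<close>: from below \<open>\<epsilon> / 2\<close> one step adds less than \<open>\<epsilon> / 2\<close>, and from above it
  the step goes down.
\<close>

lemma descent_tendsto_zero:
  fixes a \<alpha> :: "nat \<Rightarrow> real"
  assumes nonneg: "\<And>n. 0 \<le> a n"
    and \<alpha>_pos: "\<And>n. 0 < \<alpha> n"
    and \<alpha>_lim: "\<alpha> \<longlonglongrightarrow> 0"
    and \<alpha>_sum: "filterlim (\<lambda>N. \<Sum>n<N. \<alpha> n) at_top sequentially"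
    and growth: "\<And>n. a (Suc n) \<le> a n + K * \<alpha> n"
    and descent: "\<And>\<delta>. 0 < \<delta> \<Longrightarrow>
      \<exists>c>0. eventually (\<lambda>n. \<delta> \<le> a n \<longrightarrow> a (Suc n) \<le> a n - c * \<alpha> n) sequentially"
  shows "a \<longlonglongrightarrow> 0"
proof (rule LIMSEQ_I)
  fix \<epsilon> :: real assume \<epsilon>: "0 < \<epsilon>"
  obtain c where c: "c > 0"
    and ev: "eventually (\<lambda>n. \<epsilon>/2 \<le> a n \<longrightarrow> a (Suc n) \<le> a n - c * \<alpha> n) sequentially"
    using descent[of "\<epsilon>/2"] \<epsilon> by auto
  have "(\<lambda>n. K * \<alpha> n) \<longlonglongrightarrow> 0" using tendsto_mult_right_zero[OF \<alpha>_lim] .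
  then have "eventually (\<lambda>n. K * \<alpha> n < \<epsilon>/2) sequentially"
    using \<epsilon> by (intro order_tendstoD(2)) auto
  with ev have "eventually (\<lambda>n. (\<epsilon>/2 \<le> a n \<longrightarrow> a (Suc n) \<le> a n - c * \<alpha> n) \<and> K * \<alpha> n < \<epsilon>/2) sequentially"
    by (rule eventually_conj)
  then obtain N where N: "\<And>n. n \<ge> N \<Longrightarrow> \<epsilon>/2 \<le> a n \<Longrightarrow> a (Suc n) \<le> a n - c * \<alpha> n"
    and N': "\<And>n. n \<ge> N \<Longrightarrow> K * \<alpha> n < \<epsilon>/2"
    unfolding eventually_sequentially by blast
  have "\<exists>n0\<ge>N. a n0 < \<epsilon>/2"
  proof (rule ccontr)
    assume "\<not> ?thesis"
    then have far: "\<epsilon>/2 \<le> a n" if "n \<ge> N" for n using that by force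
    have bound: "c * (\<Sum>i<n. \<alpha> i) \<le> a N + c * (\<Sum>i<N. \<alpha> i) - a n" if "n \<ge> N" for n
      using that
    proof (induction n rule: dec_induct)
      case (step n)
      then show ?case using N[of n] far[of n] by (simp add: algebra_simps)
    qed simp
    have "eventually (\<lambda>n. (\<Sum>i<n. \<alpha> i) > a N / c + (\<Sum>i<N. \<alpha> i)) sequentially"
      using \<alpha>_sum unfolding filterlim_at_top_dense by blast
    then have "eventually (\<lambda>n. n \<ge> N \<and> (\<Sum>i<n. \<alpha> i) > a N / c + (\<Sum>i<N. \<alpha> i)) sequentially"
      using eventually_ge_at_top[of N] by eventually_elim auto
    then obtain n where n: "n \<ge> N" "(\<Sum>i<n. \<alpha> i) > a N / c + (\<Sum>i<N. \<alpha> i)"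
      unfolding eventually_sequentially by blast
    have "c * (\<Sum>i<n. \<alpha> i) > a N + c * (\<Sum>i<N. \<alpha> i)"
      using mult_strict_left_mono[OF n(2) c] c by (simp add: algebra_simps)
    with bound[OF n(1)] nonneg[of n] show False by linarith
  qed
  then obtain n0 where n0: "n0 \<ge> N" "a n0 < \<epsilon>/2" by blast
  have "a n < \<epsilon>" if "n \<ge> n0" for n
    using that
  proof (induction n rule: dec_induct)
    case base
    then show ?case using n0 \<epsilon> by simp
  next
    case (step n)
    show ?case
    proof (cases "\<epsilon>/2 \<le> a n")
      case True
      then have "a (Suc n) \<le> a n - c * \<alpha> n" using N n0 step by simp
      moreover have "0 < c * \<alpha> n" using c \<alpha>_pos by simp
      ultimately show ?thesis using step.IH by linarith
    next
      case False
      then show ?thesis using growth[of n] N'[of n] n0 step by linarith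
    qed
  qed
  then show "\<exists>no. \<forall>n\<ge>no. norm (a n - 0) < \<epsilon>" using nonneg by auto
qed

lemma compact_positive_bound:
  fixes h :: "'a::topological_space \<Rightarrow> real"
  assumes "compact K" "continuous_on K h" "\<And>u. u \<in> K \<Longrightarrow> 0 < h u"
  obtains c where "c > 0" "\<And>u. u \<in> K \<Longrightarrow> c \<le> h u"
proof (cases "K = {}")
  case True
  then show ?thesis using that[of 1] by simp
next
  case False
  then show ?thesis using continuous_attains_inf[OF assms(1) _ assms(2)] assms(3) that by metis
qed

text \<open>
  The difference over a fixed lag is a sum of a fixed number of increments.  Truncated subtraction
  does no harm, as only large \<open>n\<close> matter.
\<close>

lemma diff_lag_tendsto_zero:
  fixes y :: "nat \<Rightarrow> 'a::real_normed_vector"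
  assumes "(\<lambda>n. y (Suc n) - y n) \<longlonglongrightarrow> 0"
  shows "(\<lambda>n. y n - y (n - k)) \<longlonglongrightarrow> 0"
proof (induction k)
  case (Suc k)
  have "(\<lambda>n. y (Suc n) - y n + (y n - y (n - k))) \<longlonglongrightarrow> 0"
    using tendsto_add[OF assms Suc] by simp
  then have "(\<lambda>n. y (Suc n) - y (Suc n - Suc k)) \<longlonglongrightarrow> 0" by simp
  then show ?case by (rule LIMSEQ_imp_Suc)
qed simp

section \<open>Firmly nonexpansive maps and subgradients\<close>

lemma firmly_nonexpansive_nonexpansive:
  assumes "firmly_nonexpansive T"
  shows "norm (T u - T v) \<le> norm (u - v)"
proof -
  have "norm (T u - T v) * norm (T u - T v) \<le> norm (T u - T v) * norm (u - v)"
    using assms norm_cauchy_schwarz[of "T u - T v" "u - v"]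
    unfolding firmly_nonexpansive_def power2_eq_square by (meson order_trans)
  then show ?thesis
    by (cases "norm (T u - T v) = 0") (auto simp: mult_le_cancel_left)
qed

lemma firmly_nonexpansive_continuous_on:
  assumes "firmly_nonexpansive T"
  shows "continuous_on A T"
proof (rule continuous_onI)
  fix u and e :: real assume "0 < e"
  then show "\<exists>d>0. \<forall>v\<in>A. dist v u < d \<longrightarrow> dist (T v) (T u) \<le> e"
    using firmly_nonexpansive_nonexpansive[OF assms, of _ u]
    by (intro exI[of _ e]) (auto simp: dist_norm intro: order_trans less_imp_le)
qed

lemma firmly_nonexpansive_Fix:
  assumes "firmly_nonexpansive T" "p \<in> Fix T"
  shows "(norm (T u - p))\<^sup>2 \<le> (norm (u - p))\<^sup>2 - (norm (T u - u))\<^sup>2"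
proof -
  have "(T u - p) \<bullet> (u - p) \<ge> (norm (T u - p))\<^sup>2"
    using assms firmly_nonexpansive_def[THEN iffD1, rule_format, of T u p] by (simp add: Fix_def)
  then show ?thesis
    by (simp add: power2_norm_eq_inner inner_simps inner_commute)
qed

lemma closed_Fix:
  fixes T :: "'a::real_inner \<Rightarrow> 'a"
  assumes "firmly_nonexpansive T"
  shows "closed (Fix T)"
  unfolding Fix_def
  by (intro closed_Collect_eq firmly_nonexpansive_continuous_on assms continuous_on_id)

text \<open>
  For \<open>r \<in> Fix T\<close>, firm nonexpansiveness says \<open>(T w - r) \<bullet> (w - T w) \<ge> 0\<close>.  The left side is
  affine in \<open>r\<close>, so this extends to convex combinations of fixed points; if \<open>w\<close> itself is such a
  combination, \<open>r = w\<close> yields \<open>- (norm (T w - w))\<^sup>2 \<ge> 0\<close>.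
\<close>

lemma convex_Fix:
  assumes "firmly_nonexpansive T"
  shows "convex (Fix T)"
proof (rule convexI)
  fix p q and s t :: real
  assume pq: "p \<in> Fix T" "q \<in> Fix T" and st: "0 \<le> s" "0 \<le> t" "s + t = 1"
  define w where "w = s *\<^sub>R p + t *\<^sub>R q"
  have half: "0 \<le> (T w - r) \<bullet> (w - T w)" if "r \<in> Fix T" for r
  proof -
    have "(T w - r) \<bullet> (w - r) \<ge> (T w - r) \<bullet> (T w - r)"
      using assms that firmly_nonexpansive_def[THEN iffD1, rule_format, of T w r]
      by (simp add: Fix_def power2_norm_eq_inner)
    then show ?thesis by (simp add: inner_simps)
  qed
  have "T w - w = s *\<^sub>R (T w - p) + t *\<^sub>R (T w - q)"
  proof -
    have "T w = (s + t) *\<^sub>R T w" using st by simp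
    then show ?thesis by (simp add: w_def algebra_simps)
  qed
  then have "(T w - w) \<bullet> (w - T w) = s * ((T w - p) \<bullet> (w - T w)) + t * ((T w - q) \<bullet> (w - T w))"
    by (simp only: inner_add_left inner_scaleR_left)
  also have "\<dots> \<ge> 0" using st half pq by simp
  finally have "(T w - w) \<bullet> (T w - w) \<le> 0"
    by (simp add: inner_simps inner_commute)
  then have "(T w - w) \<bullet> (T w - w) = 0"
    by (intro antisym inner_ge_zero)
  then show "s *\<^sub>R p + t *\<^sub>R q \<in> Fix T"
    by (simp add: Fix_def flip: w_def)
qed

lemma convex_on_UNIV_continuous:
  fixes f :: "'a::euclidean_space \<Rightarrow> real"
  assumes "convex_on UNIV f"
  shows "continuous_on UNIV f"
  using convex_on_continuous assms by blast

text \<open>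
  The norm of a subgradient is controlled by the variation of \<open>f\<close> within distance one, and \<open>f\<close>,
  being continuous, is bounded on balls.
\<close>

lemma subgradients_bounded:
  fixes f :: "'a::euclidean_space \<Rightarrow> real"
  assumes f: "convex_on UNIV f" and A: "bounded A"
  obtains B where "\<And>u v. u \<in> A \<Longrightarrow> v \<in> subdifferential f u \<Longrightarrow> norm v \<le> B"
proof -
  obtain r where r: "\<And>u. u \<in> A \<Longrightarrow> norm u \<le> r" using A unfolding bounded_iff by blast
  have "bounded (f ` cball 0 (r + 1))"
    using convex_on_UNIV_continuous[OF f]
    by (intro compact_imp_bounded compact_continuous_image) (auto intro: continuous_on_subset)
  then obtain b where b: "\<And>u. norm u \<le> r + 1 \<Longrightarrow> \<bar>f u\<bar> \<le> b"
    unfolding bounded_iff by (metis image_eqI mem_cball_0 real_norm_def)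
  have "norm v \<le> 2 * b" if "u \<in> A" "v \<in> subdifferential f u" for u v
  proof -
    have ru: "norm u \<le> r" using r that by simp
    \<comment> \<open>Testing the subgradient inequality one unit away, in the direction of \<open>v\<close> itself,
      turns the inner product into the norm.\<close>
    have nv: "v \<bullet> sgn v = norm v"
      by (simp add: sgn_div_norm inner_simps divide_simps power2_norm_eq_inner[symmetric] power2_eq_square)
    have "v \<bullet> ((u + sgn v) - u) \<le> f (u + sgn v) - f u"
      using that(2) unfolding subdifferential_def by blast
    moreover have "norm (u + sgn v) \<le> r + 1"
      using norm_triangle_ineq[of u "sgn v"] ru by (simp add: norm_sgn split: if_splits)
    ultimately show ?thesis
      using nv b[of u] b[of "u + sgn v"] ru by auto
  qed
  then show ?thesis using that by blast
qed

lemma norm_mean_power2_le: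
  fixes v :: "'i \<Rightarrow> 'a::real_normed_vector"
  shows "(norm ((1 / real (card I)) *\<^sub>R (\<Sum>i\<in>I. v i)))\<^sup>2 \<le> (1 / real (card I)) * (\<Sum>i\<in>I. (norm (v i))\<^sup>2)"
proof (cases "card I = 0")
  case False
  have "(norm (\<Sum>i\<in>I. v i))\<^sup>2 \<le> (\<Sum>i\<in>I. norm (v i))\<^sup>2"
    by (intro power_mono norm_sum norm_ge_zero)
  also have "\<dots> \<le> real (card I) * (\<Sum>i\<in>I. (norm (v i))\<^sup>2)"
    using sum_squared_le_sum_of_squares[of "\<lambda>i. norm (v i)" I] by (simp add: mult.commute)
  finally have "(norm (\<Sum>i\<in>I. v i))\<^sup>2 / (real (card I))\<^sup>2 \<le> real (card I) * (\<Sum>i\<in>I. (norm (v i))\<^sup>2) / (real (card I))\<^sup>2"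
    by (intro divide_right_mono) auto
  then show ?thesis using False by (simp add: power_mult_distrib power_divide power2_eq_square)
qed auto

section \<open>The delayed iteration\<close>

text \<open>
  The method written with natural indices.  Truncated subtraction in \<open>y (n - \<tau> j n)\<close> encodes that
  all iterates with nonpositive index coincide with the starting point.
\<close>

locale delayed_subgradient_iteration =
  fixes m :: nat
    and f :: "nat \<Rightarrow> 'a::euclidean_space \<Rightarrow> real"
    and T :: "nat \<Rightarrow> 'a \<Rightarrow> 'a"
    and g :: "nat \<Rightarrow> 'a \<Rightarrow> 'a"
    and \<alpha> :: "nat \<Rightarrow> real"
    and \<tau>max :: nat
    and \<tau> :: "nat \<Rightarrow> nat \<Rightarrow> nat"
    and y :: "nat \<Rightarrow> 'a"
  assumes m_pos: "m \<ge> 1"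
    and f_convex: "\<And>j. j \<in> {1..m} \<Longrightarrow> convex_on UNIV (f j)"
    and T_firm: "\<And>j. j \<in> {1..m} \<Longrightarrow> firmly_nonexpansive (T j)"
    and common_fixpoint: "(\<Inter>j \<in> {1..m}. Fix (T j)) \<noteq> {}"
    and g_subgradient: "\<And>j z. j \<in> {1..m} \<Longrightarrow> g j z \<in> subdifferential (f j) z"
    and delay_le: "\<And>j n. j \<in> {1..m} \<Longrightarrow> \<tau> j n \<le> \<tau>max"
    and \<alpha>_pos: "\<And>n. \<alpha> n > 0"
    and \<alpha>_lim: "\<alpha> \<longlonglongrightarrow> 0"
    and \<alpha>_sum: "filterlim (\<lambda>N. \<Sum>n<N. \<alpha> n) at_top sequentially"
    and y_Suc: "\<And>n. y (Suc n) =
      (1 / real m) *\<^sub>R (\<Sum>j = 1..m. T j (y n) - \<alpha> n *\<^sub>R g j (T j (y (n - \<tau> j n))))"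
    and y_bounded: "bounded (range y)"
begin

definition F :: "'a \<Rightarrow> real" where
  "F z = (\<Sum>j = 1..m. f j z)"

definition C :: "'a set" where
  "C = (\<Inter>j \<in> {1..m}. Fix (T j))"

definition delayed_g :: "nat \<Rightarrow> nat \<Rightarrow> 'a" where
  "delayed_g j n = g j (T j (y (n - \<tau> j n)))"

definition residual :: "'a \<Rightarrow> real" where
  "residual u = (1 / real m) * (\<Sum>j = 1..m. (norm (T j u - u))\<^sup>2)"

lemma closed_C: "closed C"
  unfolding C_def by (intro closed_INT ballI closed_Fix T_firm)

lemma convex_C: "convex C"
  unfolding C_def by (intro convex_INT convex_Fix T_firm)

lemma C_nonempty: "C \<noteq> {}"
  using common_fixpoint unfolding C_def .

lemma F_continuous: "continuous_on A F"
proof -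
  have "continuous_on UNIV F"
    unfolding F_def by (intro continuous_on_sum convex_on_UNIV_continuous f_convex)
  then show ?thesis by (rule continuous_on_subset) simp
qed

lemma residual_continuous: "continuous_on A residual"
  unfolding residual_def
  by (intro continuous_intros firmly_nonexpansive_continuous_on T_firm)

lemma residual_nonneg: "0 \<le> residual u"
  unfolding residual_def by (simp add: sum_nonneg)

lemma residual_pos:
  assumes "u \<notin> C"
  shows "0 < residual u"
proof -
  obtain j where j: "j \<in> {1..m}" "T j u \<noteq> u" using assms unfolding C_def Fix_def by auto
  have "0 < (\<Sum>j = 1..m. (norm (T j u - u))\<^sup>2)"
    by (rule sum_pos2[of _ j]) (use j in auto)
  then show ?thesis using m_pos by (simp add: residual_def)
qed

text \<open>
  A nonexpansive map moves \<open>u\<close> by at most twice the distance of \<open>u\<close> to any of its fixed points.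
\<close>

lemma displacement_le_infdist:
  assumes "j \<in> {1..m}"
  shows "norm (T j u - u) \<le> 2 * infdist u C"
proof -
  obtain p where p: "p \<in> C" "infdist u C = dist u p"
    using infdist_attains_inf[OF closed_C C_nonempty] by blast
  have "T j p = p" using p(1) assms by (auto simp: C_def Fix_def)
  then have "norm (T j u - p) \<le> norm (u - p)"
    using firmly_nonexpansive_nonexpansive[OF T_firm[OF assms], of u p] by simp
  moreover have "norm (T j u - u) \<le> norm (T j u - p) + norm (u - p)"
    using norm_triangle_ineq4[of "T j u - p" "u - p"] by simp
  ultimately show ?thesis using p(2) by (simp add: dist_norm)
qed

lemma subgradient_bound:
  obtains B where "0 \<le> B" "\<And>j n. j \<in> {1..m} \<Longrightarrow> norm (delayed_g j n) \<le> B"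
    "\<And>j n. j \<in> {1..m} \<Longrightarrow> norm (g j (y n)) \<le> B"
proof -
  have "\<exists>b\<ge>0. (\<forall>n. norm (delayed_g j n) \<le> b) \<and> (\<forall>n. norm (g j (y n)) \<le> b)" if j: "j \<in> {1..m}" for j
  proof -
    obtain r where r: "\<And>n. norm (y n) \<le> r" using y_bounded by (auto simp: bounded_iff)
    have "norm (T j (y n)) \<le> r + norm (T j 0)" for n
      using firmly_nonexpansive_nonexpansive[OF T_firm[OF j], of "y n" 0]
        norm_triangle_sub[of "T j (y n)" "T j 0"] r[of n] by simp
    then have "bounded (range (\<lambda>n. T j (y n)))" by (auto simp: bounded_iff)
    then have "bounded (range (\<lambda>n. T j (y n)) \<union> range y)" using y_bounded by simp
    from subgradients_bounded[OF f_convex[OF j] this] obtain b where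
      b: "\<And>u v. u \<in> range (\<lambda>n. T j (y n)) \<union> range y \<Longrightarrow> v \<in> subdifferential (f j) u \<Longrightarrow> norm v \<le> b"
      by blast
    have "norm (delayed_g j n) \<le> b" "norm (g j (y n)) \<le> b" for n
      using b g_subgradient[OF j] unfolding delayed_g_def by blast+
    moreover from this(1)[of 0] have "0 \<le> b" using norm_ge_zero order_trans by blast
    ultimately show ?thesis by blast
  qed
  then obtain b where b: "\<And>j. j \<in> {1..m} \<Longrightarrow> 0 \<le> b j"
    "\<And>j n. j \<in> {1..m} \<Longrightarrow> norm (delayed_g j n) \<le> b j" "\<And>j n. j \<in> {1..m} \<Longrightarrow> norm (g j (y n)) \<le> b j"
    by metis
  have le: "b j \<le> (\<Sum>j = 1..m. b j)" if "j \<in> {1..m}" for j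
    by (rule member_le_sum) (use that b(1) in auto)
  show ?thesis
    by (rule that[of "\<Sum>j = 1..m. b j"]) (use b le in \<open>blast intro: sum_nonneg order_trans\<close>)+
qed

lemma mean_const: "(1 / real m) * (\<Sum>j = 1..m. c) = (c::real)"
  using m_pos by simp

lemma mean_le:
  assumes "\<And>j. j \<in> {1..m} \<Longrightarrow> h j \<le> (c::real)"
  shows "(1 / real m) * (\<Sum>j = 1..m. h j) \<le> c"
  using sum_mono[of "{1..m}" h "\<lambda>_. c"] assms mean_const[of c]
  by (metis mult_left_mono divide_nonneg_nonneg of_nat_0_le_iff zero_le_one)

section \<open>One-step estimates\<close>

text \<open>
  Convexity of the squared norm passes from \<open>y (Suc n)\<close> to the agents' points.  For each agent,
  \<open>firmly_nonexpansive_Fix\<close> handles the operator part, and the remaining sum collects exactly the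
  contribution of the subgradient.  It is kept unestimated because it is bounded in two different
  ways later.
\<close>

lemma one_step:
  assumes "z \<in> C"
  shows "(norm (y (Suc n) - z))\<^sup>2 \<le> (norm (y n - z))\<^sup>2 - residual (y n)
    + (1 / real m) * (\<Sum>j = 1..m. (\<alpha> n)\<^sup>2 * (norm (delayed_g j n))\<^sup>2 - 2 * \<alpha> n * (delayed_g j n \<bullet> (T j (y n) - z)))"
proof -
  have "y (Suc n) - z = (1 / real m) *\<^sub>R (\<Sum>j = 1..m. T j (y n) - \<alpha> n *\<^sub>R delayed_g j n - z)"
    using m_pos unfolding y_Suc delayed_g_def
    by (simp add: sum_subtractf scaleR_right_diff_distrib sum_constant_scaleR)
  then have "(norm (y (Suc n) - z))\<^sup>2 \<le> (1 / real m) * (\<Sum>j = 1..m. (norm (T j (y n) - \<alpha> n *\<^sub>R delayed_g j n - z))\<^sup>2)"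
    using norm_mean_power2_le[of "{1..m}" "\<lambda>j. T j (y n) - \<alpha> n *\<^sub>R delayed_g j n - z"] by simp
  also have "\<dots> \<le> (1 / real m) * (\<Sum>j = 1..m. (norm (y n - z))\<^sup>2 - (norm (T j (y n) - y n))\<^sup>2
      + ((\<alpha> n)\<^sup>2 * (norm (delayed_g j n))\<^sup>2 - 2 * \<alpha> n * (delayed_g j n \<bullet> (T j (y n) - z))))"
  proof (intro mult_left_mono sum_mono)
    fix j assume j: "j \<in> {1..m}"
    have "(norm (T j (y n) - z))\<^sup>2 \<le> (norm (y n - z))\<^sup>2 - (norm (T j (y n) - y n))\<^sup>2"
      using firmly_nonexpansive_Fix[OF T_firm[OF j]] assms j by (auto simp: C_def)
    moreover have "(norm (T j (y n) - \<alpha> n *\<^sub>R delayed_g j n - z))\<^sup>2 = (norm (T j (y n) - z))\<^sup>2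
       + ((\<alpha> n)\<^sup>2 * (norm (delayed_g j n))\<^sup>2 - 2 * \<alpha> n * (delayed_g j n \<bullet> (T j (y n) - z)))"
      unfolding power2_norm_eq_inner
      by (simp add: inner_simps inner_commute algebra_simps power2_eq_square)
    ultimately show "(norm (T j (y n) - \<alpha> n *\<^sub>R delayed_g j n - z))\<^sup>2 \<le> (norm (y n - z))\<^sup>2 - (norm (T j (y n) - y n))\<^sup>2
      + ((\<alpha> n)\<^sup>2 * (norm (delayed_g j n))\<^sup>2 - 2 * \<alpha> n * (delayed_g j n \<bullet> (T j (y n) - z)))"
      by linarith
  qed simp
  also have "\<dots> = (norm (y n - z))\<^sup>2 - residual (y n)
    + (1 / real m) * (\<Sum>j = 1..m. (\<alpha> n)\<^sup>2 * (norm (delayed_g j n))\<^sup>2 - 2 * \<alpha> n * (delayed_g j n \<bullet> (T j (y n) - z)))"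
    using mean_const[of "(norm (y n - z))\<^sup>2"]
    by (simp add: residual_def sum.distrib sum_subtractf distrib_left right_diff_distrib
        del: sum_constant)
  finally show ?thesis .
qed

text \<open>
  The crude way to use \<open>one_step\<close>, at the point \<open>z\<close> of \<open>S\<close> nearest to \<open>y n\<close>: bounded subgradients
  and the Cauchy-Schwarz inequality make the subgradient terms at most a multiple of \<open>\<alpha> n\<close>.
\<close>

lemma infdist_one_step:
  assumes S: "closed S" "S \<noteq> {}" "S \<subseteq> C"
  shows "\<exists>K. \<forall>n. (infdist (y (Suc n)) S)\<^sup>2 \<le> (infdist (y n) S)\<^sup>2 - residual (y n) + K * \<alpha> n"
proof -
  obtain B where B: "0 \<le> B" "\<And>j n. j \<in> {1..m} \<Longrightarrow> norm (delayed_g j n) \<le> B"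
    using subgradient_bound by metis
  obtain r where r: "\<And>n. norm (y n) \<le> r" using y_bounded by (auto simp: bounded_iff)
  obtain A where A: "\<And>n. \<alpha> n \<le> A"
    using convergent_imp_Bseq[of \<alpha>] \<alpha>_lim \<alpha>_pos
    by (metis BseqE abs_of_pos convergentI real_norm_def)
  obtain z0 where z0: "z0 \<in> S" using S by blast
  \<comment> \<open>As \<open>z0\<close> is a candidate, \<open>D\<close> bounds the distance from every iterate to its nearest point in
    \<open>S\<close>, uniformly in \<open>n\<close>.\<close>
  define D where "D = r + norm z0"
  have "(infdist (y (Suc n)) S)\<^sup>2 \<le> (infdist (y n) S)\<^sup>2 - residual (y n) + (A * B\<^sup>2 + 2 * B * D) * \<alpha> n" for n
  proof -
    obtain z where z: "z \<in> S" "infdist (y n) S = dist (y n) z"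
      using infdist_attains_inf[OF S(1,2)] by blast
    have "dist (y n) z \<le> dist (y n) z0" using z infdist_le[OF z0, of "y n"] by simp
    also have "\<dots> \<le> D" using norm_triangle_ineq4[of "y n" z0] r[of n] by (simp add: dist_norm D_def)
    finally have D: "norm (y n - z) \<le> D" by (simp add: dist_norm)
    have zC: "z \<in> C" using z S by blast
    have "(infdist (y (Suc n)) S)\<^sup>2 \<le> (norm (y (Suc n) - z))\<^sup>2"
      using infdist_le[OF z(1), of "y (Suc n)"] infdist_nonneg
      by (intro power_mono) (auto simp: dist_norm)
    also have "\<dots> \<le> (norm (y n - z))\<^sup>2 - residual (y n)
       + (1 / real m) * (\<Sum>j = 1..m. (\<alpha> n)\<^sup>2 * (norm (delayed_g j n))\<^sup>2 - 2 * \<alpha> n * (delayed_g j n \<bullet> (T j (y n) - z)))"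
      by (rule one_step[OF zC])
    also have "(1 / real m) * (\<Sum>j = 1..m. (\<alpha> n)\<^sup>2 * (norm (delayed_g j n))\<^sup>2 - 2 * \<alpha> n * (delayed_g j n \<bullet> (T j (y n) - z)))
        \<le> (A * B\<^sup>2 + 2 * B * D) * \<alpha> n"
    proof (rule mean_le)
      fix j assume j: "j \<in> {1..m}"
      have "T j z = z" using zC j by (auto simp: C_def Fix_def)
      then have "norm (T j (y n) - z) \<le> D"
        using firmly_nonexpansive_nonexpansive[OF T_firm[OF j], of "y n" z] D by simp
      then have "norm (delayed_g j n) * norm (T j (y n) - z) \<le> B * D"
        using B(1) B(2)[OF j] by (intro mult_mono) auto
      then have "- (delayed_g j n \<bullet> (T j (y n) - z)) \<le> B * D"
        using Cauchy_Schwarz_ineq2[of "delayed_g j n" "T j (y n) - z"] by linarith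
      then have 1: "2 * \<alpha> n * - (delayed_g j n \<bullet> (T j (y n) - z)) \<le> 2 * \<alpha> n * (B * D)"
        using \<alpha>_pos[of n] by (intro mult_left_mono) auto
      have "(\<alpha> n)\<^sup>2 * (norm (delayed_g j n))\<^sup>2 \<le> (A * \<alpha> n) * B\<^sup>2"
        using A[of n] \<alpha>_pos[of n] B(2)[OF j, of n]
        by (intro mult_mono power_mono) (auto simp: power2_eq_square intro: mult_right_mono order_trans[of 0 "\<alpha> n"])
      with 1 show "(\<alpha> n)\<^sup>2 * (norm (delayed_g j n))\<^sup>2 - 2 * \<alpha> n * (delayed_g j n \<bullet> (T j (y n) - z)) \<le> (A * B\<^sup>2 + 2 * B * D) * \<alpha> n"
        by (simp add: algebra_simps)
    qed
    finally show ?thesis using z(2) by (simp add: dist_norm)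
  qed
  then show ?thesis by blast
qed

section \<open>Asymptotic feasibility\<close>

text \<open>
  The descent principle for the squared distance to any closed \<open>S \<subseteq> C\<close>: the crude estimate
  supplies the growth condition, so only the drop away from \<open>S\<close> is left to be shown.
\<close>

lemma infdist_tendsto_zero:
  assumes S: "closed S" "S \<noteq> {}" "S \<subseteq> C"
    and descent: "\<And>\<delta>. 0 < \<delta> \<Longrightarrow> \<exists>c>0. eventually (\<lambda>n. \<delta> \<le> infdist (y n) S \<longrightarrow>
      (infdist (y (Suc n)) S)\<^sup>2 \<le> (infdist (y n) S)\<^sup>2 - c * \<alpha> n) sequentially"
  shows "(\<lambda>n. infdist (y n) S) \<longlonglongrightarrow> 0"
proof -
  obtain K where K: "\<And>n. (infdist (y (Suc n)) S)\<^sup>2 \<le> (infdist (y n) S)\<^sup>2 - residual (y n) + K * \<alpha> n"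
    using infdist_one_step[OF S] by blast
  have "(\<lambda>n. (infdist (y n) S)\<^sup>2) \<longlonglongrightarrow> 0"
  proof (rule descent_tendsto_zero[OF _ \<alpha>_pos \<alpha>_lim \<alpha>_sum])
    show "(infdist (y (Suc n)) S)\<^sup>2 \<le> (infdist (y n) S)\<^sup>2 + K * \<alpha> n" for n
      using K[of n] residual_nonneg[of "y n"] by linarith
    fix \<delta> :: real assume \<delta>: "0 < \<delta>"
    have "sqrt \<delta> \<le> infdist (y n) S" if "\<delta> \<le> (infdist (y n) S)\<^sup>2" for n
      using that by (simp add: real_le_lsqrt infdist_nonneg)
    then show "\<exists>c>0. eventually (\<lambda>n. \<delta> \<le> (infdist (y n) S)\<^sup>2 \<longrightarrow>
      (infdist (y (Suc n)) S)\<^sup>2 \<le> (infdist (y n) S)\<^sup>2 - c * \<alpha> n) sequentially"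
      using descent[of "sqrt \<delta>"] \<delta> by (auto elim!: eventually_mono)
  qed simp
  then show ?thesis by simp
qed

lemma far_points_compact:
  "\<exists>K. compact K \<and> (\<forall>u\<in>K. \<delta> \<le> infdist u S) \<and> (\<forall>n. \<delta> \<le> infdist (y n) S \<longrightarrow> y n \<in> K)"
proof -
  obtain r where r: "\<And>n. norm (y n) \<le> r" using y_bounded by (auto simp: bounded_iff)
  have "compact (cball 0 r \<inter> {u. \<delta> \<le> infdist u S})"
    by (intro compact_Int_closed compact_cball closed_Collect_le continuous_intros)
  then show ?thesis using r by (intro exI[of _ "cball 0 r \<inter> {u. \<delta> \<le> infdist u S}"]) auto
qed

text \<open>
  On the iterates at distance at least \<open>\<delta>\<close> from \<open>C\<close> the residual has a positive lower bound \<open>c\<close>,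
  which eventually exceeds \<open>(K + 1) * \<alpha> n\<close>; this pays for the error \<open>K * \<alpha> n\<close> and leaves a
  drop of \<open>\<alpha> n\<close>.
\<close>

lemma infdist_C_tendsto_zero: "(\<lambda>n. infdist (y n) C) \<longlonglongrightarrow> 0"
proof (rule infdist_tendsto_zero[OF closed_C C_nonempty order_refl])
  fix \<delta> :: real assume \<delta>: "0 < \<delta>"
  obtain K where K: "\<And>n. (infdist (y (Suc n)) C)\<^sup>2 \<le> (infdist (y n) C)\<^sup>2 - residual (y n) + K * \<alpha> n"
    using infdist_one_step[OF closed_C C_nonempty order_refl] by blast
  obtain Q where Q: "compact Q" "\<And>u. u \<in> Q \<Longrightarrow> \<delta> \<le> infdist u C"
      "\<And>n. \<delta> \<le> infdist (y n) C \<Longrightarrow> y n \<in> Q"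
    using far_points_compact by metis
  have "0 < residual u" if "u \<in> Q" for u
    using Q(2)[OF that] \<delta> by (intro residual_pos) auto
  then obtain c where c: "c > 0" "\<And>u. u \<in> Q \<Longrightarrow> c \<le> residual u"
    using compact_positive_bound[OF Q(1) residual_continuous] by metis
  have "(\<lambda>n. (K + 1) * \<alpha> n) \<longlonglongrightarrow> 0" using tendsto_mult_right_zero[OF \<alpha>_lim] .
  then have "eventually (\<lambda>n. (K + 1) * \<alpha> n < c) sequentially"
    using c(1) by (rule order_tendstoD(2))
  then have "eventually (\<lambda>n. \<delta> \<le> infdist (y n) C \<longrightarrow>
      (infdist (y (Suc n)) C)\<^sup>2 \<le> (infdist (y n) C)\<^sup>2 - 1 * \<alpha> n) sequentially"
  proof eventually_elim
    case (elim n)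
    have "(infdist (y (Suc n)) C)\<^sup>2 \<le> (infdist (y n) C)\<^sup>2 - 1 * \<alpha> n" if "\<delta> \<le> infdist (y n) C"
      using c(2)[OF Q(3)[OF that]] K[of n] elim by (simp add: algebra_simps)
    then show ?case by blast
  qed
  then show "\<exists>c>0. eventually (\<lambda>n. \<delta> \<le> infdist (y n) C \<longrightarrow>
      (infdist (y (Suc n)) C)\<^sup>2 \<le> (infdist (y n) C)\<^sup>2 - c * \<alpha> n) sequentially"
    by (intro exI[of _ 1]) simp
qed

lemma increments_tendsto_zero: "(\<lambda>n. y (Suc n) - y n) \<longlonglongrightarrow> 0"
proof -
  obtain B where B: "\<And>j n. j \<in> {1..m} \<Longrightarrow> norm (delayed_g j n) \<le> B"
    using subgradient_bound by metis
  have "norm (y (Suc n) - y n) \<le> 2 * infdist (y n) C + B * \<alpha> n" for n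
  proof -
    have eq: "y (Suc n) - y n = (1 / real m) *\<^sub>R (\<Sum>j = 1..m. (T j (y n) - y n) - \<alpha> n *\<^sub>R delayed_g j n)"
      using m_pos unfolding y_Suc delayed_g_def
      by (simp add: sum_subtractf scaleR_right_diff_distrib sum_constant_scaleR)
    have "norm (y (Suc n) - y n) \<le> (1 / real m) * (\<Sum>j = 1..m. norm ((T j (y n) - y n) - \<alpha> n *\<^sub>R delayed_g j n))"
      unfolding eq by (simp add: divide_right_mono norm_sum)
    also have "\<dots> \<le> 2 * infdist (y n) C + B * \<alpha> n"
    proof (rule mean_le)
      fix j assume j: "j \<in> {1..m}"
      have "norm (\<alpha> n *\<^sub>R delayed_g j n) = norm (delayed_g j n) * \<alpha> n"
        using \<alpha>_pos[of n] by simp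
      also have "\<dots> \<le> B * \<alpha> n"
        using mult_right_mono[OF B[OF j, of n] less_imp_le[OF \<alpha>_pos[of n]]] .
      finally have "norm (\<alpha> n *\<^sub>R delayed_g j n) \<le> B * \<alpha> n" .
      then show "norm ((T j (y n) - y n) - \<alpha> n *\<^sub>R delayed_g j n) \<le> 2 * infdist (y n) C + B * \<alpha> n"
        using norm_triangle_ineq4[of "T j (y n) - y n" "\<alpha> n *\<^sub>R delayed_g j n"]
          displacement_le_infdist[OF j, of "y n"] by linarith
    qed
    finally show ?thesis .
  qed
  moreover have "(\<lambda>n. 2 * infdist (y n) C + B * \<alpha> n) \<longlonglongrightarrow> 2 * 0 + B * 0"
    by (intro tendsto_intros infdist_C_tendsto_zero \<alpha>_lim)
  ultimately show ?thesis
    using Lim_null_comparison[of "\<lambda>n. y (Suc n) - y n" "\<lambda>n. 2 * infdist (y n) C + B * \<alpha> n"]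
    by simp
qed

section \<open>Asymptotic optimality\<close>

text \<open>
  The refined way to use \<open>one_step\<close>.  With \<open>v\<close> the delayed iterate, the subgradient inequality at
  \<open>T j v\<close>, where the subgradient was taken, compares \<open>f j (T j v)\<close> with \<open>f j z\<close>, and the one at
  \<open>y n\<close> compares \<open>f j (y n)\<close> with \<open>f j (T j v)\<close>.  What remains are bounded subgradients paired
  with \<open>T j (y n) - T j v\<close> and \<open>T j v - y n\<close>, which are controlled by lagged differences of the
  iterates and the distance to \<open>C\<close>, hence tend to zero.
\<close>

lemma objective_step:
  "\<exists>e. e \<longlonglongrightarrow> 0 \<and> (\<forall>n. \<forall>z\<in>C. (norm (y (Suc n) - z))\<^sup>2 \<le>
     (norm (y n - z))\<^sup>2 - 2 * \<alpha> n / real m * (F (y n) - F z) + \<alpha> n * e n)"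
proof -
  obtain B where B: "0 \<le> B" "\<And>j n. j \<in> {1..m} \<Longrightarrow> norm (delayed_g j n) \<le> B"
    "\<And>j n. j \<in> {1..m} \<Longrightarrow> norm (g j (y n)) \<le> B"
    using subgradient_bound by metis
  \<comment> \<open>Summing over all possible lags dominates the delays of all agents at once.\<close>
  define L where "L n = (\<Sum>k\<le>\<tau>max. norm (y n - y (n - k)))" for n
  define e where "e n = \<alpha> n * B\<^sup>2 + 4 * B * L n + 4 * B * infdist (y n) C" for n
  have "L \<longlonglongrightarrow> (\<Sum>k\<le>\<tau>max. 0)"
    unfolding L_def
    by (intro tendsto_sum tendsto_norm_zero diff_lag_tendsto_zero increments_tendsto_zero)
  then have "e \<longlonglongrightarrow> 0 * B\<^sup>2 + 4 * B * 0 + 4 * B * 0"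
    unfolding e_def by (intro tendsto_intros \<alpha>_lim infdist_C_tendsto_zero) simp
  moreover have "(norm (y (Suc n) - z))\<^sup>2 \<le>
     (norm (y n - z))\<^sup>2 - 2 * \<alpha> n / real m * (F (y n) - F z) + \<alpha> n * e n" if z: "z \<in> C" for n z
  proof -
    have "(1 / real m) * (\<Sum>j = 1..m. (\<alpha> n)\<^sup>2 * (norm (delayed_g j n))\<^sup>2 - 2 * \<alpha> n * (delayed_g j n \<bullet> (T j (y n) - z)))
      \<le> (1 / real m) * (\<Sum>j = 1..m. - 2 * \<alpha> n * (f j (y n) - f j z) + \<alpha> n * e n)"
    proof (intro mult_left_mono sum_mono)
      fix j assume j: "j \<in> {1..m}"
      define v where "v = y (n - \<tau> j n)"
      have L: "norm (y n - v) \<le> L n"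
        unfolding L_def v_def by (rule member_le_sum[of "\<tau> j n"]) (use delay_le[OF j] in auto)
      have TL: "norm (T j (y n) - T j v) \<le> L n"
        using firmly_nonexpansive_nonexpansive[OF T_firm[OF j], of "y n" v] L by linarith
      have "norm (T j v - y n) \<le> norm (T j (y n) - T j v) + norm (T j (y n) - y n)"
        using norm_triangle_ineq4[of "T j (y n) - y n" "T j (y n) - T j v"] by simp
      then have Tv: "norm (T j v - y n) \<le> L n + 2 * infdist (y n) C"
        using TL displacement_le_infdist[OF j, of "y n"] by linarith
      have 1: "delayed_g j n \<bullet> (z - T j v) \<le> f j z - f j (T j v)"
        using g_subgradient[OF j, of "T j v"] unfolding delayed_g_def v_def subdifferential_def by blast
      have 2: "g j (y n) \<bullet> (T j v - y n) \<le> f j (T j v) - f j (y n)"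
        using g_subgradient[OF j, of "y n"] unfolding subdifferential_def by blast
      have "norm (delayed_g j n) * norm (T j (y n) - T j v) \<le> B * L n"
        using B(1) B(2)[OF j] TL by (intro mult_mono) auto
      then have 3: "- (delayed_g j n \<bullet> (T j (y n) - T j v)) \<le> B * L n"
        using Cauchy_Schwarz_ineq2[of "delayed_g j n" "T j (y n) - T j v"] by linarith
      have "norm (g j (y n)) * norm (T j v - y n) \<le> B * (L n + 2 * infdist (y n) C)"
        using B(1) B(3)[OF j] Tv by (intro mult_mono) auto
      then have 4: "- (g j (y n) \<bullet> (T j v - y n)) \<le> B * (L n + 2 * infdist (y n) C)"
        using Cauchy_Schwarz_ineq2[of "g j (y n)" "T j v - y n"] by linarith
      have "delayed_g j n \<bullet> (T j (y n) - z) = delayed_g j n \<bullet> (T j (y n) - T j v) - delayed_g j n \<bullet> (z - T j v)"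
        by (simp add: inner_simps)
      then have "- (delayed_g j n \<bullet> (T j (y n) - z)) \<le> - (f j (y n) - f j z) + (2 * B * L n + 2 * B * infdist (y n) C)"
        using 1 2 3 4 by (simp add: algebra_simps)
      then have "2 * \<alpha> n * - (delayed_g j n \<bullet> (T j (y n) - z))
          \<le> 2 * \<alpha> n * (- (f j (y n) - f j z) + (2 * B * L n + 2 * B * infdist (y n) C))"
        using \<alpha>_pos[of n] by (intro mult_left_mono) auto
      moreover have "(\<alpha> n)\<^sup>2 * (norm (delayed_g j n))\<^sup>2 \<le> (\<alpha> n)\<^sup>2 * B\<^sup>2"
        using B(2)[OF j] by (intro mult_left_mono power_mono) auto
      ultimately show "(\<alpha> n)\<^sup>2 * (norm (delayed_g j n))\<^sup>2 - 2 * \<alpha> n * (delayed_g j n \<bullet> (T j (y n) - z))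
          \<le> - 2 * \<alpha> n * (f j (y n) - f j z) + \<alpha> n * e n"
        unfolding e_def by (simp add: algebra_simps power2_eq_square)
    qed simp
    also have "\<dots> = - 2 * \<alpha> n / real m * (F (y n) - F z) + \<alpha> n * e n"
      using m_pos unfolding F_def
      by (simp add: sum.distrib sum_distrib_left[symmetric] sum_subtractf sum_negf field_simps)
    finally show ?thesis
      using one_step[OF z, of n] residual_nonneg[of "y n"] by simp
  qed
  ultimately show ?thesis by auto
qed

lemma closed_minimizers: "closed (minimizers F C)"
proof (cases "minimizers F C = {}")
  case False
  then obtain p where p: "p \<in> minimizers F C" by blast
  have "minimizers F C = C \<inter> {u. F u \<le> F p}"
    using p by (auto simp: minimizers_def is_arg_min_def not_less intro: order_trans)
  then show ?thesis
    using F_continuous by (simp add: closed_Int closed_C closed_Collect_le)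
qed simp

text \<open>
  The iterates need not lie in \<open>C\<close>, so \<open>F (y n)\<close> may be below the minimum over \<open>C\<close>.  The function
  \<open>h\<close> in the proof copes with this: the maximum of the objective gap and the distance to \<open>C\<close> is
  positive off \<open>S\<close>, hence at least some \<open>c > 0\<close> on the iterates away from \<open>S\<close>; once the distance to
  \<open>C\<close> is below \<open>c\<close>, the gap itself must be at least \<open>c\<close>.
\<close>

theorem infdist_minimizers_tendsto_zero:
  assumes "minimizers F C \<noteq> {}"
  shows "(\<lambda>n. infdist (y n) (minimizers F C)) \<longlonglongrightarrow> 0"
proof (rule infdist_tendsto_zero[OF closed_minimizers assms])
  let ?S = "minimizers F C"
  show "?S \<subseteq> C" by (auto simp: minimizers_def is_arg_min_def)
  fix \<delta> :: real assume \<delta>: "0 < \<delta>"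
  obtain p where p: "p \<in> ?S" using assms by blast
  have min_iff: "u \<in> ?S \<longleftrightarrow> u \<in> C \<and> F u \<le> F p" for u
    using p by (auto simp: minimizers_def is_arg_min_def not_less intro: order_trans)
  obtain e where e: "e \<longlonglongrightarrow> 0" and step: "\<And>n z. z \<in> C \<Longrightarrow> (norm (y (Suc n) - z))\<^sup>2 \<le>
     (norm (y n - z))\<^sup>2 - 2 * \<alpha> n / real m * (F (y n) - F z) + \<alpha> n * e n"
    using objective_step by blast
  obtain Q where Q: "compact Q" "\<And>u. u \<in> Q \<Longrightarrow> \<delta> \<le> infdist u ?S"
      "\<And>n. \<delta> \<le> infdist (y n) ?S \<Longrightarrow> y n \<in> Q"
    using far_points_compact by metis
  define h where "h u = max (F u - F p) (infdist u C)" for u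
  have "0 < h u" if u: "u \<in> Q" for u
  proof (cases "u \<in> C")
    case True
    have "u \<notin> ?S" using Q(2)[OF u] \<delta> by auto
    then show ?thesis using True min_iff by (simp add: h_def)
  next
    case False
    then have "infdist u C \<noteq> 0" using in_closed_iff_infdist_zero[OF closed_C C_nonempty] by blast
    then show ?thesis using infdist_nonneg[of u C] by (simp add: h_def)
  qed
  moreover have "continuous_on Q h"
    unfolding h_def by (intro continuous_intros F_continuous)
  ultimately obtain c where c: "c > 0" "\<And>u. u \<in> Q \<Longrightarrow> c \<le> h u"
    using compact_positive_bound[OF Q(1)] by metis
  have "eventually (\<lambda>n. infdist (y n) C < c) sequentially"
    using infdist_C_tendsto_zero c(1) by (rule order_tendstoD(2))
  moreover have "eventually (\<lambda>n. e n < c / real m) sequentially"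
    using e by (rule order_tendstoD(2)) (use c(1) m_pos in simp)
  ultimately have "eventually (\<lambda>n. \<delta> \<le> infdist (y n) ?S \<longrightarrow>
      (infdist (y (Suc n)) ?S)\<^sup>2 \<le> (infdist (y n) ?S)\<^sup>2 - c / real m * \<alpha> n) sequentially"
  proof eventually_elim
    case (elim n)
    have "(infdist (y (Suc n)) ?S)\<^sup>2 \<le> (infdist (y n) ?S)\<^sup>2 - c / real m * \<alpha> n"
      if far: "\<delta> \<le> infdist (y n) ?S"
    proof -
      obtain z where z: "z \<in> ?S" "infdist (y n) ?S = dist (y n) z"
        using infdist_attains_inf[OF closed_minimizers assms] by blast
      have "F z \<le> F p" using z(1) min_iff by blast
      then have gap: "c \<le> F (y n) - F z"
        using c(2)[OF Q(3)[OF far]] elim(1) by (simp add: h_def)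
      have "(infdist (y (Suc n)) ?S)\<^sup>2 \<le> (norm (y (Suc n) - z))\<^sup>2"
        using infdist_le[OF z(1), of "y (Suc n)"] infdist_nonneg
        by (intro power_mono) (auto simp: dist_norm)
      also have "\<dots> \<le> (norm (y n - z))\<^sup>2 - 2 * \<alpha> n / real m * (F (y n) - F z) + \<alpha> n * e n"
        using step z(1) min_iff by blast
      also have "\<dots> \<le> (norm (y n - z))\<^sup>2 - 2 * \<alpha> n / real m * c + \<alpha> n * (c / real m)"
        using \<alpha>_pos[of n] gap elim(2)
        by (intro add_mono diff_left_mono mult_left_mono) auto
      finally show ?thesis using z(2) by (simp add: dist_norm algebra_simps)
    qed
    then show ?case by blast
  qed
  then show "\<exists>c>0. eventually (\<lambda>n. \<delta> \<le> infdist (y n) ?S \<longrightarrow>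
      (infdist (y (Suc n)) ?S)\<^sup>2 \<le> (infdist (y n) ?S)\<^sup>2 - c * \<alpha> n) sequentially"
    using c(1) m_pos by (intro exI[of _ "c / real m"]) simp
qed

end

section \<open>Convergence to optimal solutions\<close>

lemma convergent_subsequence_of_infdist_tendsto_zero:
  fixes y :: "nat \<Rightarrow> 'a::euclidean_space"
  assumes "bounded (range y)" "closed S" "S \<noteq> {}" "(\<lambda>n. infdist (y n) S) \<longlonglongrightarrow> 0"
  obtains r z where "strict_mono r" "z \<in> S" "(\<lambda>k. y (r k)) \<longlonglongrightarrow> z"
proof -
  obtain z and r :: "nat \<Rightarrow> nat" where r: "strict_mono r" and z: "(y \<circ> r) \<longlonglongrightarrow> z"
    using bounded_imp_convergent_subsequence[OF assms(1)] by blast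
  have "(\<lambda>k. infdist (y (r k)) S) \<longlonglongrightarrow> infdist z S"
    using tendsto_infdist[OF z] by (simp add: o_def)
  moreover have "(\<lambda>k. infdist (y (r k)) S) \<longlonglongrightarrow> 0"
    using LIMSEQ_subseq_LIMSEQ[OF assms(4) r] by (simp add: o_def)
  ultimately have "infdist z S = 0" by (rule LIMSEQ_unique)
  then have "z \<in> S" using in_closed_iff_infdist_zero[OF assms(2,3)] by blast
  with r z show ?thesis using that by (simp add: o_def)
qed

lemma strictly_convex_minimizer_unique:
  assumes F: "strictly_convex_on UNIV F" and C: "convex C"
    and p: "p \<in> minimizers F C" and q: "q \<in> minimizers F C"
  shows "p = q"
proof (rule ccontr)
  assume "p \<noteq> q"
  let ?w = "(1 - 1/2) *\<^sub>R p + (1/2::real) *\<^sub>R q"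
  have "F ?w < (1 - 1/2) * F p + 1/2 * F q"
    using F[unfolded strictly_convex_on_def, THEN conjunct2, rule_format, of "1/2" p q] \<open>p \<noteq> q\<close>
    by simp
  moreover have "?w \<in> C"
    using p q by (intro convexD[OF C]) (auto simp: minimizers_def is_arg_min_def)
  moreover have "F p = F q"
    using p q by (auto simp: minimizers_def is_arg_min_def not_less intro: antisym)
  ultimately show False using p by (auto simp: minimizers_def is_arg_min_def)
qed

theorem theorem5p8:
  fixes m :: nat
    and f :: "nat \<Rightarrow> 'a::euclidean_space \<Rightarrow> real"
    and T :: "nat \<Rightarrow> 'a \<Rightarrow> 'a"
    and g :: "nat \<Rightarrow> 'a \<Rightarrow> 'a"
    and \<alpha> :: "nat \<Rightarrow> real"
    and \<tau>max :: nat
    and \<tau> :: "nat \<Rightarrow> nat \<Rightarrow> nat"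
    and x :: "int \<Rightarrow> 'a"
    and xa :: "nat \<Rightarrow> nat \<Rightarrow> 'a"
  defines "F \<equiv> (\<lambda>z. \<Sum>j = 1..m. f j z)"
    and "C \<equiv> (\<Inter>j \<in> {1..m}. Fix (T j))"
  assumes "m \<ge> 1"
    and "\<And>j. j \<in> {1..m} \<Longrightarrow> convex_on UNIV (f j)"
    and "\<And>j. j \<in> {1..m} \<Longrightarrow> firmly_nonexpansive (T j)"
    and "C \<noteq> {}"
    and "minimizers F C \<noteq> {}"
    and "\<And>j z. j \<in> {1..m} \<Longrightarrow> g j z \<in> subdifferential (f j) z"
    and "\<And>j n. j \<in> {1..m} \<Longrightarrow> \<tau> j n \<le> \<tau>max"
    and "\<And>n. \<alpha> n > 0"
    and "\<alpha> \<longlonglongrightarrow> 0"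
    and "filterlim (\<lambda>N. \<Sum>n<N. \<alpha> n) at_top sequentially"
    and "DFDSM m T g \<alpha> \<tau>max \<tau> x xa"
    and "\<And>j. j \<in> {1..m} \<Longrightarrow> \<exists>M>0. \<forall>n. norm (xa n j) \<le> M"
  shows "(\<exists>r :: nat \<Rightarrow> nat. strict_mono r \<and>
            (\<exists>z \<in> minimizers F C. (\<lambda>k. x (int (r k))) \<longlonglongrightarrow> z)) \<and>
         (strictly_convex_on UNIV F \<longrightarrow>
            (\<exists>z. minimizers F C = {z} \<and> (\<lambda>n. x (int n)) \<longlonglongrightarrow> z))"
proof -
  let ?y = "\<lambda>n. x (int n)"
  have D: "\<And>k. k \<in> {- int \<tau>max..0} \<Longrightarrow> x k = x 0"
    "\<And>n j. j \<in> {1..m} \<Longrightarrow> xa n j = T j (x (int n)) - \<alpha> n *\<^sub>R g j (T j (x (int n - int (\<tau> j n))))"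
    "\<And>n. x (int n + 1) = (1 / real m) *\<^sub>R (\<Sum>j = 1..m. xa n j)"
    using assms(13) unfolding DFDSM_def by blast+
  \<comment> \<open>Since the starting values at nonpositive indices all agree, truncated subtraction of the
    delay on the naturals reads off the right iterate.\<close>
  have delayed: "x (int n - int (\<tau> j n)) = x (int (n - \<tau> j n))" if "j \<in> {1..m}" for n j
  proof (cases "\<tau> j n \<le> n")
    case True
    then show ?thesis by (simp add: of_nat_diff)
  next
    case False
    then show ?thesis using D(1)[of "int n - int (\<tau> j n)"] assms(9)[OF that, of n] by simp
  qed
  have y_Suc: "?y (Suc n) = (1 / real m) *\<^sub>R
      (\<Sum>j = 1..m. T j (?y n) - \<alpha> n *\<^sub>R g j (T j (?y (n - \<tau> j n))))" for n
  proof -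
    have "?y (Suc n) = (1 / real m) *\<^sub>R (\<Sum>j = 1..m. xa n j)"
      using D(3)[of n] by (simp add: add.commute)
    also have "(\<Sum>j = 1..m. xa n j) = (\<Sum>j = 1..m. T j (?y n) - \<alpha> n *\<^sub>R g j (T j (?y (n - \<tau> j n))))"
      using D(2) delayed by (intro sum.cong) auto
    finally show ?thesis .
  qed
  have y_bounded: "bounded (range ?y)"
  proof -
    obtain M where M: "\<And>j n. j \<in> {1..m} \<Longrightarrow> norm (xa n j) \<le> M j"
      using assms(14) by metis
    have Suc_le: "norm (?y (Suc n)) \<le> (1 / real m) * (\<Sum>j = 1..m. M j)" for n
    proof -
      have "norm (\<Sum>j = 1..m. xa n j) \<le> (\<Sum>j = 1..m. M j)"
        using M by (intro sum_norm_le)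
      then show ?thesis using D(3)[of n] by (simp add: add.commute divide_right_mono)
    qed
    have "norm (?y n) \<le> max (norm (?y 0)) ((1 / real m) * (\<Sum>j = 1..m. M j))" for n
      by (cases n) (use Suc_le in \<open>auto simp: le_max_iff_disj simp del: of_nat_Suc\<close>)
    then show ?thesis by (auto simp: bounded_iff)
  qed
  interpret it: delayed_subgradient_iteration m f T g \<alpha> \<tau>max \<tau> ?y
    by (unfold_locales) (use assms(3-12) y_Suc y_bounded in \<open>auto simp: C_def simp del: of_nat_Suc\<close>)
  have F: "it.F = F" and C: "it.C = C"
    unfolding it.F_def it.C_def F_def C_def by auto
  have lim: "(\<lambda>n. infdist (?y n) (minimizers F C)) \<longlonglongrightarrow> 0"
    using it.infdist_minimizers_tendsto_zero assms(7) unfolding F C by blast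
  have closed: "closed (minimizers F C)" using it.closed_minimizers unfolding F C .
  have "\<exists>r :: nat \<Rightarrow> nat. strict_mono r \<and> (\<exists>z \<in> minimizers F C. (\<lambda>k. x (int (r k))) \<longlonglongrightarrow> z)"
    using convergent_subsequence_of_infdist_tendsto_zero[OF y_bounded closed assms(7) lim] by metis
  moreover have "\<exists>z. minimizers F C = {z} \<and> ?y \<longlonglongrightarrow> z" if sc: "strictly_convex_on UNIV F"
  proof -
    obtain z where z: "z \<in> minimizers F C" using assms(7) by blast
    have single: "minimizers F C = {z}"
      using strictly_convex_minimizer_unique[OF sc] it.convex_C z unfolding C by blast
    then have "(\<lambda>n. dist (?y n) z) \<longlonglongrightarrow> 0" using lim by simp
    then have "?y \<longlonglongrightarrow> z" by (subst tendsto_dist_iff)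
    with single show ?thesis by blast
  qed
  ultimately show ?thesis by blast
qed

end
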